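(* Let $G$ and $H$ be finitely generated free groups, with $G$ having free generators $a_1,\dots,a_n$, and let $\phi,\psi:G\to H$ be homomorphisms such that $\phi$ has remnant and \[ |\operatorname{Rem}_\phi a_i|>|\psi(a_i)| \] for each generator $a_i\in G$. Let $l=\min_i\left(|\operatorname{Rem}_\phi a_i|-|\psi(a_i)|\right)$. Then any pair $(u,v)$ of elements of $H$ has bounded solution length, with solution bound \[ \mathrm{SB}\le\frac{|u|+|v|}{l}. \]
   Context: Free groups come with fixed free generating sets; $|w|$ denotes reduced word length. Bounded solution length: given homomorphisms $\phi,\psi:G\to H$ and $u,v\in H$, the pair $(u,v)$ has bounded solution length if there is some integer $k\ge0$ such that the equation $u=\phi(z)v\psi(z)^{-1}$ is satisfied by $z\in G$ (if at all) only if $|z|\le k$. The smallest such $k$ is called the solution bound $\mathrm{SB}$ for $(u,v)$. Remnant. Let $t=(h_1,\dots,h_n)$ be a tuple of reduced words in $H$. We say $t$ has remnant when, for each $i$, there is a nontrivial subword of $h_i$ which does not cancel in any product of the form $h_j^{\alpha_j}h_ih_k^{\beta_k}$, where $j,k\in\{1,\dots,n\}$, with $\alpha_r,\beta_r\in\{-1,0,1\}$ for $r\ne i$ and $\alpha_i,\beta_i\in\{0,1\}$. The (maximal) such noncancelling subword is the remnant of $h_i$. Explicitly: delete from $h_i$ the longest initial segment that cancels in some product $h_j^{\alpha_j}h_i$ and the longest terminal segment that cancels in some product $h_ih_k^{\beta_k}$ (with $j,k\in\{1,\dots,n\}$, $\alpha_j\in\{-1,0,1\}$ if $j\ne i$ and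 $\alpha_j\in\{0,1\}$ if $j=i$, $\beta_k\in\{-1,0,1\}$ if $k\ne i$ and $\beta_k\in\{0,1\}$ if $k=i$); $t$ has remnant if for each $i$ these segments have total length less than $|h_i|$, and what is left is the remnant of $h_i$. The homomorphism $\phi$ has remnant if $(\phi(a_1),\dots,\phi(a_n))$ has remnant, and $\operatorname{Rem}_\phi a_i$ denotes the remnant of $\phi(a_i)$. *)

theory Defs
  imports Complex_Main "HOL-Algebra.Group" "HOL-Library.Sublist"
begin

text \<open>A letter \<open>(x, True)\<close> stands for the generator \<open>x\<close>, and \<open>(x, False)\<close> for its inverse.\<close>

type_synonym 'a letter = "'a \<times> bool"
type_synonym 'a word = "'a letter list"

definition letter_inv :: "'a letter \<Rightarrow> 'a letter" where
  "letter_inv s = (fst s, \<not> snd s)"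

definition word_inv :: "'a word \<Rightarrow> 'a word" where
  "word_inv w = rev (map letter_inv w)"

definition reduced :: "'a word \<Rightarrow> bool" where
  "reduced w \<longleftrightarrow> successively (\<lambda>s t. t \<noteq> letter_inv s) w"

text \<open>Left multiplication of a reduced word by a letter, followed by free reduction.\<close>

fun letter_mult :: "'a letter \<Rightarrow> 'a word \<Rightarrow> 'a word" where
  "letter_mult s [] = [s]"
| "letter_mult s (t # w) = (if t = letter_inv s then w else s # t # w)"

text \<open>The free group on the free generating set \<open>A\<close>, realised on the reduced words over \<open>A\<close>;
  hence \<^const>\<open>length\<close> is the reduced word length.\<close>

definition free_group :: "'a set \<Rightarrow> 'a word monoid" where
  "free_group A =
    \<lparr>carrier = {w. reduced w \<and> fst ` set w \<subseteq> A}, mult = foldr letter_mult, one = []\<rparr>"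

definition gen :: "'a \<Rightarrow> 'a word" where
  "gen a = [(a, True)]"


lemma letter_inv_inv [simp]: "letter_inv (letter_inv s) = s"
  by (simp add: letter_inv_def)

lemma reduced_letter_mult: "reduced w \<Longrightarrow> reduced (letter_mult s w)"
  by (cases w) (auto simp: reduced_def successively_Cons)

lemma letter_mult_cancel: "reduced w \<Longrightarrow> letter_mult s (letter_mult (letter_inv s) w) = w"
  by (cases w; cases "tl w") (auto simp: reduced_def)

lemma reduced_mult: "reduced y \<Longrightarrow> reduced (foldr letter_mult x y)"
  by (induction x) (auto simp: reduced_letter_mult)

lemma letter_mult_assoc:
  assumes "reduced y"
  shows "foldr letter_mult (letter_mult s x) y = letter_mult s (foldr letter_mult x y)"
  using assms by (cases x) (auto simp: letter_mult_cancel reduced_mult)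

lemma mult_assoc:
  assumes "reduced z"
  shows "foldr letter_mult (foldr letter_mult x y) z = foldr letter_mult x (foldr letter_mult y z)"
  using assms by (induction x) (auto simp: letter_mult_assoc)

lemma mult_Nil: "reduced x \<Longrightarrow> foldr letter_mult x [] = x"
proof (induction x)
  case (Cons s x)
  then show ?case by (cases x) (auto simp: reduced_def)
qed simp

lemma mult_word_inv:
  assumes "reduced y"
  shows "foldr letter_mult (word_inv x) (foldr letter_mult x y) = y"
  using assms
proof (induction x arbitrary: y)
  case (Cons s x)
  then show ?case
    using letter_mult_cancel[of "foldr letter_mult x y" "letter_inv s"]
    by (simp add: word_inv_def reduced_mult)
qed (simp add: word_inv_def)

lemma reduced_word_inv: "reduced x \<Longrightarrow> reduced (word_inv x)"
  unfolding reduced_def word_inv_def successively_rev successively_map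
  by (erule successively_mono) (metis letter_inv_inv)+

lemma set_letter_mult: "set (letter_mult s w) \<subseteq> insert s (set w)"
  by (cases w) auto

lemma set_mult: "set (foldr letter_mult x y) \<subseteq> set x \<union> set y"
  by (induction x) (use set_letter_mult in fastforce)+

lemma fst_set_word_inv: "fst ` set (word_inv x) = fst ` set x"
  by (simp add: word_inv_def letter_inv_def image_image)

lemma group_free_group: "group (free_group A)"
proof (rule groupI)
  fix x y assume "x \<in> carrier (free_group A)" "y \<in> carrier (free_group A)"
  then show "x \<otimes>\<^bsub>free_group A\<^esub> y \<in> carrier (free_group A)"
    using set_mult[of x y] by (fastforce simp: free_group_def reduced_mult)
next
  fix x assume "x \<in> carrier (free_group A)"
  then show "\<exists>y\<in>carrier (free_group A). y \<otimes>\<^bsub>free_group A\<^esub> x = \<one>\<^bsub>free_group A\<^esub>"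
    using mult_word_inv[of "[]" x] reduced_word_inv[of x] fst_set_word_inv[of x]
    by (intro bexI[of _ "word_inv x"]) (simp_all add: free_group_def mult_Nil reduced_def)
qed (auto simp: free_group_def reduced_def mult_assoc)

lemma inv_free_group:
  assumes "x \<in> carrier (free_group A)"
  shows "inv\<^bsub>free_group A\<^esub> x = word_inv x"
proof -
  have "word_inv x \<otimes>\<^bsub>free_group A\<^esub> x = \<one>\<^bsub>free_group A\<^esub>"
    using assms mult_word_inv[of "[]" x] by (simp add: free_group_def mult_Nil reduced_def)
  moreover have "word_inv x \<in> carrier (free_group A)"
    using assms by (auto simp: free_group_def reduced_word_inv fst_set_word_inv)
  ultimately show ?thesis
    using group.inv_equality[OF group_free_group _ assms] by blast
qed


text \<open>The power \<open>h\<^sup>\<alpha>\<close> for \<open>\<alpha> \<in> {-1, 0, 1}\<close>.\<close>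

definition signed_word :: "'b word \<Rightarrow> int \<Rightarrow> 'b word" where
  "signed_word h \<alpha> = (if \<alpha> = 1 then h else if \<alpha> = -1 then word_inv h else [])"

text \<open>Exponents that may be put on the \<open>j\<close>-th entry of a tuple next to its \<open>i\<close>-th entry.\<close>

definition exponents :: "nat \<Rightarrow> nat \<Rightarrow> int set" where
  "exponents i j = (if j = i then {0, 1} else {-1, 0, 1})"

text \<open>In a product \<open>x y\<close> of reduced words, an initial segment \<open>p\<close> of \<open>y\<close> cancels iff \<open>x\<close> ends
  in \<open>p\<inverse>\<close>, and a terminal segment \<open>s\<close> of \<open>x\<close> cancels iff \<open>y\<close> begins with \<open>s\<inverse>\<close>.\<close>

definition left_cancellation :: "'b word list \<Rightarrow> nat \<Rightarrow> nat" where
  "left_cancellation t i = Max {length p | p. prefix p (t ! i) \<and>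
     (\<exists>j<length t. \<exists>\<alpha>\<in>exponents i j. suffix (word_inv p) (signed_word (t ! j) \<alpha>))}"

definition right_cancellation :: "'b word list \<Rightarrow> nat \<Rightarrow> nat" where
  "right_cancellation t i = Max {length s | s. suffix s (t ! i) \<and>
     (\<exists>k<length t. \<exists>\<beta>\<in>exponents i k. prefix (word_inv s) (signed_word (t ! k) \<beta>))}"

definition has_remnant :: "'b word list \<Rightarrow> bool" where
  "has_remnant t \<longleftrightarrow>
     (\<forall>i<length t. left_cancellation t i + right_cancellation t i < length (t ! i))"

definition remnant :: "'b word list \<Rightarrow> nat \<Rightarrow> 'b word" where
  "remnant t i =
     drop (left_cancellation t i) (take (length (t ! i) - right_cancellation t i) (t ! i))"

definition gen_images :: "'a list \<Rightarrow> ('a word \<Rightarrow> 'b word) \<Rightarrow> 'b word list" where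
  "gen_images as \<phi> = map (\<lambda>a. \<phi> (gen a)) as"

definition hom_has_remnant :: "'a list \<Rightarrow> ('a word \<Rightarrow> 'b word) \<Rightarrow> bool" where
  "hom_has_remnant as \<phi> \<longleftrightarrow> has_remnant (gen_images as \<phi>)"

definition Rem :: "'a list \<Rightarrow> ('a word \<Rightarrow> 'b word) \<Rightarrow> nat \<Rightarrow> 'b word" where
  "Rem as \<phi> i = remnant (gen_images as \<phi>) i"


definition solution_length_bound ::
    "'a word monoid \<Rightarrow> 'b word monoid \<Rightarrow> ('a word \<Rightarrow> 'b word) \<Rightarrow> ('a word \<Rightarrow> 'b word)
      \<Rightarrow> 'b word \<Rightarrow> 'b word \<Rightarrow> nat \<Rightarrow> bool" where
  "solution_length_bound G H \<phi> \<psi> u v k \<longleftrightarrow>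
     (\<forall>z\<in>carrier G. u = \<phi> z \<otimes>\<^bsub>H\<^esub> v \<otimes>\<^bsub>H\<^esub> inv\<^bsub>H\<^esub> (\<psi> z) \<longrightarrow> length z \<le> k)"

definition bounded_solution_length ::
    "'a word monoid \<Rightarrow> 'b word monoid \<Rightarrow> ('a word \<Rightarrow> 'b word) \<Rightarrow> ('a word \<Rightarrow> 'b word)
      \<Rightarrow> 'b word \<Rightarrow> 'b word \<Rightarrow> bool" where
  "bounded_solution_length G H \<phi> \<psi> u v \<longleftrightarrow> (\<exists>k. solution_length_bound G H \<phi> \<psi> u v k)"

definition SB ::
    "'a word monoid \<Rightarrow> 'b word monoid \<Rightarrow> ('a word \<Rightarrow> 'b word) \<Rightarrow> ('a word \<Rightarrow> 'b word)
      \<Rightarrow> 'b word \<Rightarrow> 'b word \<Rightarrow> nat" where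
  "SB G H \<phi> \<psi> u v = (LEAST k. solution_length_bound G H \<phi> \<psi> u v k)"

end

theory Submission imports Defs begin

text \<open>Spell \<open>\<phi>(z)\<close> as the product of the images of the letters of the reduced word \<open>z\<close>.
  Between neighbouring images at most the initial and terminal segments excluded from the
  remnants cancel, so every letter contributes its whole remnant to \<open>\<phi>(z)\<close> and
  \<open>|\<phi>(z)| \<ge> \<Sum> |Rem|\<close>. A solution satisfies \<open>\<phi>(z) = u \<psi>(z) v\<inverse>\<close>, whence
  \<open>\<Sum> |Rem| \<le> |u| + |v| + \<Sum> |\<psi>|\<close>, that is, \<open>l |z| \<le> |u| + |v|\<close>.\<close>

section \<open>Inverse words and cancellation in a product\<close>

lemma length_word_inv [simp]: "length (word_inv w) = length w"
  by (simp add: word_inv_def)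

lemma word_inv_word_inv [simp]: "word_inv (word_inv w) = w"
  by (simp add: word_inv_def rev_map o_def)

lemma word_inv_append: "word_inv (x @ y) = word_inv y @ word_inv x"
  by (simp add: word_inv_def)

lemma suffix_word_inv: "suffix (word_inv x) (word_inv y) \<longleftrightarrow> prefix x y"
  by (metis prefix_def suffix_def word_inv_append word_inv_word_inv)

lemma prefix_word_inv: "prefix (word_inv x) (word_inv y) \<longleftrightarrow> suffix x y"
  by (metis suffix_word_inv word_inv_word_inv)

lemma reduced_Cons: "reduced (s # w) \<longleftrightarrow> reduced w \<and> (w \<noteq> [] \<longrightarrow> hd w \<noteq> letter_inv s)"
  by (cases w) (auto simp: reduced_def)

text \<open>A letter prepended to \<open>x\<close> meets \<open>b\<close> only once \<open>a\<close>
  is used up, since a reduced word has no cancellation against \<open>a\<close>. So the cancelled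
  part \<open>p\<close> grows at its end, one letter at a time.\<close>

lemma mult_cancellation:
  assumes "reduced x"
  shows "\<exists>p a b. x = a @ word_inv p \<and> y = p @ b \<and> foldr letter_mult x y = a @ b"
  using assms
proof (induction x)
  case Nil
  show ?case
    by (rule exI[of _ "[]"]) (simp add: word_inv_def)
next
  case (Cons s x)
  then obtain p a b where pab: "x = a @ word_inv p" "y = p @ b" "foldr letter_mult x y = a @ b"
    by (auto simp: reduced_Cons)
  show ?case
  proof (cases "a = [] \<and> b \<noteq> [] \<and> hd b = letter_inv s")
    case True
    then obtain b' where b: "b = letter_inv s # b'"
      by (cases b) auto
    with True pab show ?thesis
      by (intro exI[of _ "p @ [letter_inv s]"] exI[of _ "[]"] exI[of _ b'])
        (simp add: word_inv_def)
  next
    case False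
    have "letter_mult s (a @ b) = s # a @ b"
      using False Cons.prems pab(1) by (cases a; cases b) (auto simp: reduced_Cons)
    with pab show ?thesis
      by (intro exI[of _ p] exI[of _ "s # a"] exI[of _ b]) simp
  qed
qed

section \<open>Length estimates for products\<close>

lemma length_letter_mult_le: "length (letter_mult s w) \<le> Suc (length w)"
  by (cases w) auto

lemma length_mult_le: "length (foldr letter_mult x y) \<le> length x + length y"
  by (induction x) (auto intro: order_trans[OF length_letter_mult_le])

text \<open>Here \<open>W s\<close> is the image of the letter \<open>s\<close>, \<open>c s\<close> bounds the initial segment of it that
  may cancel, hence \<open>c (letter_inv s)\<close> the terminal one, and \<open>r s\<close> is the length in between.
  The prefix of length \<open>c s + r s\<close> is what the next letter to the left can meet.\<close>

lemma length_product_ge: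
  fixes W :: "'a letter \<Rightarrow> 'b word" and c r :: "'a letter \<Rightarrow> nat"
  assumes red: "\<And>s. fst s \<in> A \<Longrightarrow> reduced (W s)"
    and W_inv: "\<And>s. fst s \<in> A \<Longrightarrow> W (letter_inv s) = word_inv (W s)"
    and len: "\<And>s. fst s \<in> A \<Longrightarrow> length (W s) = c s + r s + c (letter_inv s)"
    and pos: "\<And>s. fst s \<in> A \<Longrightarrow> 0 < r s"
    and canc: "\<And>s t p. \<lbrakk>fst s \<in> A; fst t \<in> A; t \<noteq> letter_inv s; prefix p (W t);
      suffix (word_inv p) (W s)\<rbrakk> \<Longrightarrow> length p \<le> c t"
    and z: "reduced (s # z)" "fst ` set (s # z) \<subseteq> A"
  defines "F \<equiv> foldr (\<lambda>s. foldr letter_mult (W s))"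
  shows "prefix (take (c s + r s) (W s)) (F (s # z) []) \<and>
    c s + (\<Sum>t\<leftarrow>s # z. r t) \<le> length (F (s # z) [])"
  using z
proof (induction z arbitrary: s)
  case Nil
  then show ?case
    using red[of s] len[of s] by (simp add: F_def mult_Nil take_is_prefix)
next
  case (Cons t z)
  have s: "fst s \<in> A" and t: "fst t \<in> A" and ts: "t \<noteq> letter_inv s"
    using Cons.prems by (auto simp: reduced_Cons)
  define y where "y = F (t # z) []"
  have y: "prefix (take (c t + r t) (W t)) y" "c t + (\<Sum>t\<leftarrow>t # z. r t) \<le> length y"
    using Cons.IH[of t] Cons.prems by (auto simp: reduced_Cons y_def)
  obtain p a b where pab: "W s = a @ word_inv p" "y = p @ b" "foldr letter_mult (W s) y = a @ b"
    using mult_cancellation[OF red[OF s]] by blast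
  have suf: "suffix (word_inv p) (W s)"
    using pab by (simp add: suffix_def)
  \<comment> \<open>A longer \<open>p\<close> might run past the known prefix of \<open>y\<close>,
    where \<open>canc\<close> says nothing. Cutting it to \<open>c t + 1\<close> letters keeps it
    inside that prefix because \<open>r t > 0\<close>, and this already violates
    \<open>canc\<close>.\<close>
  have *: "length p \<le> c t"
  proof (rule ccontr)
    assume "\<not> length p \<le> c t"
    moreover define p' where "p' = take (Suc (c t)) p"
    moreover have "suffix (word_inv p') (word_inv p)"
      by (simp add: p'_def suffix_word_inv take_is_prefix)
    with suf have "suffix (word_inv p') (W s)"
      by (rule suffix_order.trans[rotated])
    moreover have "prefix p' (W t)"
    proof -
      have "prefix p' y"
        unfolding p'_def pab by (meson prefixI prefix_order.trans take_is_prefix)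
      moreover have "length p' \<le> length (take (c t + r t) (W t))"
        using pos[OF t] len[OF t] by (auto simp: p'_def)
      ultimately have "prefix p' (take (c t + r t) (W t))"
        using y(1) prefix_length_prefix by blast
      then show ?thesis
        using prefix_order.trans take_is_prefix by blast
    qed
    ultimately show False
      using canc[OF s t ts, of p'] by simp
  qed
  have "prefix p (take (c t + r t) (W t))"
    by (rule prefix_length_prefix[OF _ y(1)]) (use * len[OF t] pab in auto)
  then have pt: "prefix p (W t)"
    using prefix_order.trans take_is_prefix by blast
  \<comment> \<open>The same cancellation seen in the inverse product, where
    \<open>W (letter_inv t)\<close> stands left of \<open>W (letter_inv s)\<close>.\<close>
  have "length p \<le> c (letter_inv s)"
  proof (rule canc[of "letter_inv t"])
    show "prefix p (W (letter_inv s))"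
      using suf prefix_word_inv[of "word_inv p"] by (simp add: W_inv[OF s])
    show "suffix (word_inv p) (W (letter_inv t))"
      using pt by (simp add: W_inv[OF t] suffix_word_inv)
    show "letter_inv s \<noteq> letter_inv (letter_inv t)"
      using ts by auto
  qed (use s t in \<open>auto simp: letter_inv_def\<close>)
  then have a: "c s + r s \<le> length a"
    using len[OF s] pab(1) by simp
  have F: "F (s # t # z) [] = a @ b"
    using pab(3) by (simp add: F_def y_def)
  have "take (c s + r s) (W s) = take (c s + r s) a"
    using a pab(1) by simp
  then have "prefix (take (c s + r s) (W s)) (a @ b)"
    by (metis prefixI prefix_order.trans take_is_prefix)
  \<comment> \<open>Removing \<open>p\<close> costs at most the extra summand \<open>c t\<close>
    that the induction hypothesis carries for this purpose.\<close>
  moreover have "length b \<ge> (\<Sum>t\<leftarrow>t # z. r t)"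
    using y(2) pab(2) * by simp
  ultimately show ?case
    using a F by simp
qed

section \<open>Cancellation lengths and remnants\<close>

lemma left_cancellation_ge:
  assumes "i < length t" "j < length t" "\<alpha> \<in> exponents i j" "prefix p (t ! i)"
    "suffix (word_inv p) (signed_word (t ! j) \<alpha>)"
  shows "length p \<le> left_cancellation t i"
  unfolding left_cancellation_def
proof (rule Max_ge)
  show "finite {length p | p. prefix p (t ! i) \<and>
     (\<exists>j<length t. \<exists>\<alpha>\<in>exponents i j. suffix (word_inv p) (signed_word (t ! j) \<alpha>))}"
    by (rule finite_subset[of _ "{..length (t ! i)}"]) (auto dest: prefix_length_le)
qed (use assms in blast)

lemma right_cancellation_ge:
  assumes "i < length t" "j < length t" "\<alpha> \<in> exponents i j" "suffix p (t ! i)"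
    "prefix (word_inv p) (signed_word (t ! j) \<alpha>)"
  shows "length p \<le> right_cancellation t i"
  unfolding right_cancellation_def
proof (rule Max_ge)
  show "finite {length s | s. suffix s (t ! i) \<and>
     (\<exists>k<length t. \<exists>\<beta>\<in>exponents i k. prefix (word_inv s) (signed_word (t ! k) \<beta>))}"
    by (rule finite_subset[of _ "{..length (t ! i)}"]) (auto dest: suffix_length_le)
qed (use assms in blast)

text \<open>The strict inequality in \<open>has_remnant\<close> keeps the two removed segments
  disjoint, so no subtraction truncates and at least one letter stays.\<close>

lemma length_remnant:
  assumes "has_remnant t" "i < length t"
  shows "length (t ! i) = left_cancellation t i + length (remnant t i) + right_cancellation t i"
    and "0 < length (remnant t i)"
  using assms by (force simp: has_remnant_def remnant_def)+

section \<open>Homomorphisms evaluated letter by letter\<close>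

text \<open>Prepending a letter of a reduced word cancels nothing, so the word is the product of its
  letters and \<open>f\<close> distributes over it.\<close>

lemma hom_letters:
  assumes "f \<in> hom (free_group A) (free_group B)" "reduced z" "fst ` set z \<subseteq> A"
  shows "f z = foldr (\<lambda>s. foldr letter_mult (f [s])) z []"
  using assms(2,3)
proof (induction z)
  case Nil
  show ?case
    using hom_one[OF assms(1) group_free_group group_free_group] by (simp add: free_group_def)
next
  case (Cons s z)
  have "letter_mult s z = s # z"
    using Cons.prems by (cases z) (auto simp: reduced_Cons)
  moreover have "f ([s] \<otimes>\<^bsub>free_group A\<^esub> z) = f [s] \<otimes>\<^bsub>free_group B\<^esub> f z"
    by (rule hom_mult[OF assms(1)]) (use Cons.prems in \<open>auto simp: free_group_def reduced_Cons, auto simp: reduced_def\<close>)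
  ultimately show ?case
    using Cons by (simp add: free_group_def reduced_Cons)
qed

lemma hom_letter_inv:
  assumes "f \<in> hom (free_group A) (free_group B)" "fst s \<in> A"
  shows "f [letter_inv s] = word_inv (f [s])"
proof -
  have s: "[s] \<in> carrier (free_group A)"
    using assms(2) by (simp add: free_group_def reduced_def)
  have "f [letter_inv s] = f (inv\<^bsub>free_group A\<^esub> [s])"
    by (simp add: inv_free_group[OF s] word_inv_def)
  also have "\<dots> = inv\<^bsub>free_group B\<^esub> (f [s])"
    by (intro group_hom.hom_inv group_hom.intro group_hom_axioms.intro group_free_group assms s)
  also have "\<dots> = word_inv (f [s])"
    by (rule inv_free_group[OF hom_in_carrier[OF assms(1) s]])
  finally show ?thesis .
qed

lemma hom_letter:
  assumes "f \<in> hom (free_group A) (free_group B)" "fst s \<in> A"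
  shows "f [s] = (if snd s then f (gen (fst s)) else word_inv (f (gen (fst s))))"
  using hom_letter_inv[OF assms(1), of "(fst s, True)"] assms(2)
  by (cases s) (auto simp: gen_def letter_inv_def)

lemma length_hom_le:
  assumes "f \<in> hom (free_group A) (free_group B)" "reduced z" "fst ` set z \<subseteq> A"
  shows "length (f z) \<le> (\<Sum>s\<leftarrow>z. length (f (gen (fst s))))"
proof -
  have "length (foldr (\<lambda>s. foldr letter_mult (f [s])) z []) \<le> (\<Sum>s\<leftarrow>z. length (f (gen (fst s))))"
    using assms(3)
  proof (induction z)
    case (Cons s z)
    then show ?case
      using length_mult_le[of "f [s]" "foldr (\<lambda>s. foldr letter_mult (f [s])) z []"]
        hom_letter[OF assms(1), of s] by (auto split: if_splits)
  qed simp
  then show ?thesis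
    using hom_letters[OF assms] by simp
qed

text \<open>\<open>length_product_ge\<close> applies with \<open>W s = f [s]\<close>. The map
  \<open>idx\<close> leads from a generator to its position in \<open>as\<close>, by which remnants
  are indexed.\<close>

lemma length_hom_ge:
  assumes f: "f \<in> hom (free_group (set as)) (free_group B)"
    and rem: "hom_has_remnant as f"
    and z: "reduced z" "fst ` set z \<subseteq> set as"
    and idx: "\<And>a. a \<in> set as \<Longrightarrow> idx a < length as \<and> as ! idx a = a"
  shows "(\<Sum>s\<leftarrow>z. length (Rem as f (idx (fst s)))) \<le> length (f z)"
proof (cases z)
  case (Cons s z')
  define t where "t = gen_images as f"
  \<comment> \<open>Inverting a word swaps its ends, so an inverse letter can lose initially what
    its generator can lose terminally.\<close>
  define c where "c = (\<lambda>s :: 'a letter. if snd s then left_cancellation t (idx (fst s))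
    else right_cancellation t (idx (fst s)))"
  define r where "r = (\<lambda>s :: 'a letter. length (Rem as f (idx (fst s))))"
  have t: "has_remnant t" "length t = length as"
    using rem by (simp_all add: t_def hom_has_remnant_def gen_images_def)
  have t_idx: "t ! idx a = f (gen a)" "idx a < length t" if "a \<in> set as" for a
    using idx[OF that] by (auto simp: t_def gen_images_def)
  have W: "f [s] = (if snd s then t ! idx (fst s) else word_inv (t ! idx (fst s)))"
    if "fst s \<in> set as" for s
    using hom_letter[OF f that] t_idx(1)[OF that] by simp
  have "prefix (take (c s + r s) (f [s])) (foldr (\<lambda>s. foldr letter_mult (f [s])) (s # z') []) \<and>
    c s + (\<Sum>t\<leftarrow>s # z'. r t) \<le> length (foldr (\<lambda>s. foldr letter_mult (f [s])) (s # z') [])"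
  proof (rule length_product_ge[where A = "set as"])
    fix s :: "'a letter" assume s: "fst s \<in> set as"
    have "[s] \<in> carrier (free_group (set as))"
      using s by (simp add: free_group_def reduced_def)
    then show "reduced (f [s])"
      using hom_in_carrier[OF f] by (simp add: free_group_def)
    show "f [letter_inv s] = word_inv (f [s])"
      by (rule hom_letter_inv[OF f s])
    show "length (f [s]) = c s + r s + c (letter_inv s)" "0 < r s"
      using length_remnant[OF t(1) t_idx(2)[OF s]] W[OF s]
      by (auto simp: c_def r_def Rem_def t_def letter_inv_def)
  next
    fix s q :: "'a letter" and p
    assume s: "fst s \<in> set as" and q: "fst q \<in> set as" and ne: "q \<noteq> letter_inv s"
      and p: "prefix p (f [q])" "suffix (word_inv p) (f [s])"
    \<comment> \<open>Neighbours in a reduced word with the same generator have the same sign. This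
      matches the exclusion of -1 in \<open>exponents i i\<close>.\<close>
    have same: "snd s = snd q" if "idx (fst s) = idx (fst q)"
      using that ne idx[OF s] idx[OF q] by (cases s; cases q) (auto simp: letter_inv_def)
    show "length p \<le> c q"
    proof (cases "snd q")
      case True
      have "length p \<le> left_cancellation t (idx (fst q))"
      proof (rule left_cancellation_ge)
        show "(if snd s then 1 else - 1) \<in> exponents (idx (fst q)) (idx (fst s))"
          using same True by (auto simp: exponents_def)
        show "suffix (word_inv p) (signed_word (t ! idx (fst s)) (if snd s then 1 else - 1))"
          using p(2) W[OF s] by (simp add: signed_word_def split: if_splits)
      qed (use p t_idx s q W[OF q] True in auto)
      then show ?thesis
        using True by (simp add: c_def)
    next
      case False
      \<comment> \<open>Here \<open>f [q]\<close> is an inverted entry. Inverting the whole product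
        puts the neighbour on the right with opposite exponent, and \<open>word_inv p\<close>
        becomes a terminal segment of the entry.\<close>
      have "length (word_inv p) \<le> right_cancellation t (idx (fst q))"
      proof (rule right_cancellation_ge)
        show "(if snd s then - 1 else 1) \<in> exponents (idx (fst q)) (idx (fst s))"
          using same False by (auto simp: exponents_def)
        show "suffix (word_inv p) (t ! idx (fst q))"
          using p(1) W[OF q] False suffix_word_inv[of p "f [q]"] by simp
        show "prefix (word_inv (word_inv p))
          (signed_word (t ! idx (fst s)) (if snd s then - 1 else 1))"
          using p(2) W[OF s] prefix_word_inv[of "word_inv p" "f [s]"]
          by (simp add: signed_word_def split: if_splits)
      qed (use t_idx s q in auto)
      then show ?thesis
        using False by (simp add: c_def)
    qed
  qed (use z Cons in auto)
  then show ?thesis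
    using hom_letters[OF f z] Cons by (simp add: r_def)
qed simp

section \<open>Bounding the solutions of the equation\<close>

theorem theorem11:
  fixes as :: "'a list" and B :: "'b set"
    and G :: "'a word monoid" and H :: "'b word monoid"
    and \<phi> \<psi> :: "'a word \<Rightarrow> 'b word" and l :: int
  assumes "distinct as" and "as \<noteq> []" and "G = free_group (set as)"
    and "finite B" and "H = free_group B"
    and "\<phi> \<in> hom G H" and "\<psi> \<in> hom G H"
    and "hom_has_remnant as \<phi>"
    and "\<forall>i<length as. length (Rem as \<phi> i) > length (\<psi> (gen (as ! i)))"
    and "l = (MIN i\<in>{..<length as}.
                int (length (Rem as \<phi> i)) - int (length (\<psi> (gen (as ! i)))))"
  shows "\<forall>u\<in>carrier H. \<forall>v\<in>carrier H.
           bounded_solution_length G H \<phi> \<psi> u v \<and>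
           real (SB G H \<phi> \<psi> u v) \<le> (real (length u) + real (length v)) / real_of_int l"
proof (intro ballI)
  fix u v assume u: "u \<in> carrier H" and v: "v \<in> carrier H"
  let ?d = "\<lambda>i. int (length (Rem as \<phi> i)) - int (length (\<psi> (gen (as ! i))))"
  \<comment> \<open>Lengths are natural numbers, so the real quotient may be rounded down; the
    choice is independent of the solution.\<close>
  let ?K = "(length u + length v) div nat l"
  have l_le: "l \<le> ?d i" if "i < length as" for i
    using that assms(10) by simp
  \<comment> \<open>The minimum over a nonempty finite set is attained, so \<open>l\<close> inherits
    positivity from the individual differences.\<close>
  have "l \<in> ?d ` {..<length as}"
    unfolding assms(10) by (rule Min_in) (use assms(2) in auto)
  then have l_pos: "0 < l"
    using assms(9) by auto
  have "\<forall>a\<in>set as. \<exists>i. i < length as \<and> as ! i = a"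
    by (auto simp: in_set_conv_nth)
  then obtain idx where "\<forall>a\<in>set as. idx a < length as \<and> as ! idx a = a"
    using bchoice by metis
  then have idx: "\<And>a. a \<in> set as \<Longrightarrow> idx a < length as \<and> as ! idx a = a"
    by blast
  interpret H: group H
    by (simp add: assms(5) group_free_group)
  have "length z \<le> ?K"
    if zG: "z \<in> carrier G" and eq: "u = \<phi> z \<otimes>\<^bsub>H\<^esub> v \<otimes>\<^bsub>H\<^esub> inv\<^bsub>H\<^esub> (\<psi> z)" for z
  proof -
    have z: "reduced z" "fst ` set z \<subseteq> set as"
      using zG by (auto simp: assms(3) free_group_def)
    have c: "\<phi> z \<in> carrier H" "\<psi> z \<in> carrier H"
      using assms(6,7) zG by (auto intro: hom_in_carrier)
    \<comment> \<open>Solving for \<open>\<phi> z\<close> lets subadditivity of length bound it from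
      above.\<close>
    have "\<phi> z = u \<otimes>\<^bsub>H\<^esub> \<psi> z \<otimes>\<^bsub>H\<^esub> inv\<^bsub>H\<^esub> v"
      using c v by (simp add: eq H.m_assoc H.l_inv H.r_inv)
    also have "\<dots> = foldr letter_mult (foldr letter_mult u (\<psi> z)) (word_inv v)"
      using v by (simp add: assms(5) inv_free_group) (simp add: free_group_def)
    finally have "length (\<phi> z) \<le> length u + length (\<psi> z) + length v"
      using length_mult_le[of "foldr letter_mult u (\<psi> z)" "word_inv v"] length_mult_le[of u "\<psi> z"]
      by simp
    moreover have "(\<Sum>s\<leftarrow>z. length (Rem as \<phi> (idx (fst s)))) \<le> length (\<phi> z)"
      by (rule length_hom_ge[OF _ assms(8) z idx]) (use assms in auto)
    moreover have "length (\<psi> z) \<le> (\<Sum>s\<leftarrow>z. length (\<psi> (gen (fst s))))"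
      by (rule length_hom_le[OF _ z]) (use assms in auto)
    \<comment> \<open>Each letter of \<open>z\<close> contributes a surplus of at least
      \<open>l\<close> of remnant length over the length of its \<open>\<psi>\<close>-image.\<close>
    moreover have "nat l * length z + (\<Sum>s\<leftarrow>z. length (\<psi> (gen (fst s))))
        \<le> (\<Sum>s\<leftarrow>z. length (Rem as \<phi> (idx (fst s))))"
      using z(2)
    proof (induction z)
      case (Cons s z)
      then show ?case
        using l_le[of "idx (fst s)"] idx[of "fst s"] l_pos by simp
    qed simp
    ultimately have "length z * nat l \<le> length u + length v"
      by (simp add: mult.commute)
    then show ?thesis
      using l_pos by (simp add: less_eq_div_iff_mult_less_eq)
  qed
  then have bound: "solution_length_bound G H \<phi> \<psi> u v ?K"
    by (simp add: solution_length_bound_def)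
  then have "SB G H \<phi> \<psi> u v \<le> ?K"
    unfolding SB_def by (rule Least_le)
  then have "real (SB G H \<phi> \<psi> u v) \<le> real ?K"
    by simp
  also have "\<dots> \<le> real (length u + length v) / real (nat l)"
    by (rule of_nat_div_le_of_nat)
  finally show "bounded_solution_length G H \<phi> \<psi> u v \<and>
      real (SB G H \<phi> \<psi> u v) \<le> (real (length u) + real (length v)) / real_of_int l"
    using bound l_pos by (auto simp: bounded_solution_length_def)
qed

end
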